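(* Let $P\subset\mathbb{E}^n$ be a convex polyhedral set and $\mathbf{p}_0\in\mathbb{E}^n$. Then the function $V_{P,\mathbf{p}_0,n}$ can be extended to a meromorphic function on some punctured neighborhood of $r=\infty$ in the Riemann sphere, with at most a pole at $r=\infty$, of order not greater than $n$. That is, there exist $R>0$ and a function $F$ holomorphic on $\{r\in\mathbb{C}: |r|>R\}$ such that $r^{-n}F(r)$ is bounded as $|r|\to\infty$ and $F(r)=V_{P,\mathbf{p}_0,n}(r)$ for all real $r>R$.
   Context: A (convex) polyhedral set is a nonempty subset of $\mathbb{E}^n$ that is the intersection of finitely many (possibly zero) closed halfspaces. For such $P$ and a point $\mathbf{p}_0$, define $V_{P,\mathbf{p}_0,n}(r)=0$ for $r<0$ and $V_{P,\mathbf{p}_0,n}(r)=\mathrm{Vol}_n[P\cap B_n(\mathbf{p}_0,r)]$ for $r\ge0$, where $B_n(\mathbf{p}_0,r)$ is the closed ball of radius $r$ centered at $\mathbf{p}_0$. *)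

theory Defs
  imports "HOL-Analysis.Analysis"
begin

definition polyhedral_set :: "'a::euclidean_space set \<Rightarrow> bool" where
  "polyhedral_set P \<longleftrightarrow> polyhedron P \<and> P \<noteq> {}"

definition Vfun :: "'a::euclidean_space set \<Rightarrow> 'a \<Rightarrow> real \<Rightarrow> real" where
  "Vfun P p0 r = (if r < 0 then 0 else measure lebesgue (P \<inter> cball p0 r))"

end

theory Submission
  imports Defs "HOL-Complex_Analysis.Complex_Analysis"
begin

text \<open>
  After translating \<open>p0\<close> to the origin and putting \<open>t = 1 / r\<close>, the volume is \<open>r ^ n\<close> times the
  volume \<open>f t\<close> of the part of the unit ball cut out by \<open>a \<bullet> x \<le> t * b\<close>, and it suffices that \<open>f\<close>
  agrees for small \<open>t > 0\<close> with a function holomorphic near \<open>0\<close>. This goes by induction on the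
  dimension. Constraints with \<open>b < 0\<close> are replaced by their complements; if all \<open>b \<ge> 0\<close>, then \<open>f\<close>
  increases and \<open>f t - f 0\<close> is a sum of integrals over \<open>{0<..t}\<close> of the volumes of the facets.
  A facet at time \<open>s\<close> is a polyhedral section of a ball of radius \<open>\<rho> = sqrt (1 - k * s\<^sup>2)\<close> of one
  dimension less; rescaling it to the unit ball gives the same problem at \<open>s / \<rho>\<close>, so that its
  volume is holomorphic in \<open>s\<close>, and so is a primitive.

  To avoid rotations, balls in hyperplanes are kept in linear coordinates, that is, as sets
  of coefficient vectors \<open>x\<close> with \<open>norm (\<Sum>i\<in>I. x i *\<^sub>R v i) \<le> 1\<close>.
\<close>

section \<open>Germs at zero of functions of a positive real\<close>

text \<open>Agreement is asked only for \<open>t > 0\<close>, the range of \<open>t = 1 / r\<close>,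
  whereas \<open>g\<close> must be holomorphic at \<open>0\<close> itself; this is what later bounds
  the order of the pole at infinity.\<close>

definition holomorphic_germ :: "(real \<Rightarrow> real) \<Rightarrow> bool" where
  "holomorphic_germ f \<longleftrightarrow> (\<exists>\<delta>>0. \<exists>g. g holomorphic_on ball 0 \<delta> \<and>
     (\<forall>t. 0 < t \<longrightarrow> t < \<delta> \<longrightarrow> complex_of_real (f t) = g (complex_of_real t)))"

lemma holomorphic_germI:
  assumes "0 < \<delta>" "g holomorphic_on ball 0 \<delta>"
    and "\<And>t. 0 < t \<Longrightarrow> t < \<delta> \<Longrightarrow> complex_of_real (f t) = g (complex_of_real t)"
  shows "holomorphic_germ f"
  using assms unfolding holomorphic_germ_def by blast

lemma holomorphic_germE:
  assumes "holomorphic_germ f"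
  obtains \<delta> g where "0 < \<delta>" "g holomorphic_on ball 0 \<delta>"
    "\<And>t. 0 < t \<Longrightarrow> t < \<delta> \<Longrightarrow> complex_of_real (f t) = g (complex_of_real t)"
  using assms unfolding holomorphic_germ_def by blast

lemma holomorphic_germ_cong:
  assumes "holomorphic_germ f" "0 < \<epsilon>" "\<And>t. 0 < t \<Longrightarrow> t < \<epsilon> \<Longrightarrow> h t = f t"
  shows "holomorphic_germ h"
proof -
  obtain \<delta> g where g: "0 < \<delta>" "g holomorphic_on ball 0 \<delta>"
    "\<And>t. 0 < t \<Longrightarrow> t < \<delta> \<Longrightarrow> complex_of_real (f t) = g (complex_of_real t)"
    using assms(1) by (rule holomorphic_germE) blast
  show ?thesis
  proof (rule holomorphic_germI)
    show "0 < min \<delta> \<epsilon>" using g assms by simp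
    show "g holomorphic_on ball 0 (min \<delta> \<epsilon>)"
      by (rule holomorphic_on_subset[OF g(2)]) auto
  qed (use g assms in auto)
qed

lemma holomorphic_germ_const: "holomorphic_germ (\<lambda>_. c)"
  by (rule holomorphic_germI[of 1 "\<lambda>_. complex_of_real c"]) auto

lemma holomorphic_germ_add:
  assumes "holomorphic_germ f" "holomorphic_germ h"
  shows "holomorphic_germ (\<lambda>t. f t + h t)"
proof -
  obtain \<delta> g where g: "0 < \<delta>" "g holomorphic_on ball 0 \<delta>"
    "\<And>t. 0 < t \<Longrightarrow> t < \<delta> \<Longrightarrow> complex_of_real (f t) = g (complex_of_real t)"
    using assms(1) by (rule holomorphic_germE) blast
  obtain \<epsilon> k where k: "0 < \<epsilon>" "k holomorphic_on ball 0 \<epsilon>"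
    "\<And>t. 0 < t \<Longrightarrow> t < \<epsilon> \<Longrightarrow> complex_of_real (h t) = k (complex_of_real t)"
    using assms(2) by (rule holomorphic_germE) blast
  show ?thesis
  proof (rule holomorphic_germI)
    show "0 < min \<delta> \<epsilon>" using g k by simp
    show "(\<lambda>z. g z + k z) holomorphic_on ball 0 (min \<delta> \<epsilon>)"
      by (intro holomorphic_on_add holomorphic_on_subset[OF g(2)] holomorphic_on_subset[OF k(2)]) auto
  qed (use g k in auto)
qed

lemma holomorphic_germ_mult:
  assumes "holomorphic_germ f" "holomorphic_germ h"
  shows "holomorphic_germ (\<lambda>t. f t * h t)"
proof -
  obtain \<delta> g where g: "0 < \<delta>" "g holomorphic_on ball 0 \<delta>"
    "\<And>t. 0 < t \<Longrightarrow> t < \<delta> \<Longrightarrow> complex_of_real (f t) = g (complex_of_real t)"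
    using assms(1) by (rule holomorphic_germE) blast
  obtain \<epsilon> k where k: "0 < \<epsilon>" "k holomorphic_on ball 0 \<epsilon>"
    "\<And>t. 0 < t \<Longrightarrow> t < \<epsilon> \<Longrightarrow> complex_of_real (h t) = k (complex_of_real t)"
    using assms(2) by (rule holomorphic_germE) blast
  show ?thesis
  proof (rule holomorphic_germI)
    show "0 < min \<delta> \<epsilon>" using g k by simp
    show "(\<lambda>z. g z * k z) holomorphic_on ball 0 (min \<delta> \<epsilon>)"
      by (intro holomorphic_on_mult holomorphic_on_subset[OF g(2)] holomorphic_on_subset[OF k(2)]) auto
  qed (use g k in auto)
qed

lemma holomorphic_germ_diff:
  assumes "holomorphic_germ f" "holomorphic_germ h"
  shows "holomorphic_germ (\<lambda>t. f t - h t)"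
  using holomorphic_germ_add[OF assms(1)
      holomorphic_germ_mult[OF holomorphic_germ_const[of "-1"] assms(2)]] by simp

lemma holomorphic_germ_sum:
  assumes "\<And>i. i \<in> S \<Longrightarrow> holomorphic_germ (f i)"
  shows "holomorphic_germ (\<lambda>t. \<Sum>i\<in>S. f i t)"
  using assms
  by (induction S rule: infinite_finite_induct)
     (auto intro: holomorphic_germ_const holomorphic_germ_add)

lemma holomorphic_germ_power:
  assumes "holomorphic_germ f"
  shows "holomorphic_germ (\<lambda>t. f t ^ n)"
  using assms by (induction n) (auto intro: holomorphic_germ_const holomorphic_germ_mult)

section \<open>The square root of \<open>1 - k * t\<^sup>2\<close> and the substitution
  \<open>t / sqrt (1 - k * t\<^sup>2)\<close>\<close>

lemma square_small:
  fixes k :: real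
  assumes "0 \<le> k" "norm z < 1 / (1 + k)"
  shows "k * (norm z)\<^sup>2 < 1"
proof -
  have "norm z \<le> 1" using assms by (smt (verit) divide_le_eq_1_pos)
  then have "k * (norm z)\<^sup>2 \<le> k * norm z"
    by (intro mult_left_mono) (use assms in \<open>auto simp: power2_eq_square mult_left_le\<close>)
  also have "\<dots> \<le> (1 + k) * norm z" by (simp add: mult_right_mono)
  also have "\<dots> < 1" using assms by (simp add: field_simps)
  finally show ?thesis .
qed

text \<open>In this disc \<open>k * z\<^sup>2\<close> has real part below \<open>1\<close>, which
  keeps the argument of \<open>csqrt\<close> off its branch cut. The radius
  \<open>1 / (1 + k)\<close> is a crude choice that also makes sense for
  \<open>k = 0\<close>.\<close>

lemma csqrt_one_minus_holomorphic:
  assumes "0 \<le> k"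
  shows "(\<lambda>z. csqrt (1 - complex_of_real k * z\<^sup>2)) holomorphic_on ball 0 (1 / (1 + k))"
    and "norm z < 1 / (1 + k) \<Longrightarrow> 1 - complex_of_real k * z\<^sup>2 \<notin> \<real>\<^sub>\<le>\<^sub>0"
proof -
  have *: "1 - complex_of_real k * z\<^sup>2 \<notin> \<real>\<^sub>\<le>\<^sub>0" if "norm z < 1 / (1 + k)" for z
  proof -
    have "Re (complex_of_real k * z\<^sup>2) \<le> k * (norm z)\<^sup>2"
      using complex_Re_le_cmod[of "complex_of_real k * z\<^sup>2"] assms
      by (simp only: norm_mult norm_power norm_of_real abs_of_nonneg)
    also have "\<dots> < 1" by (rule square_small[OF assms that])
    finally show ?thesis by (auto simp: complex_nonpos_Reals_iff)
  qed
  show "(\<lambda>z. csqrt (1 - complex_of_real k * z\<^sup>2)) holomorphic_on ball 0 (1 / (1 + k))"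
    using * by (intro holomorphic_intros) auto
  show "norm z < 1 / (1 + k) \<Longrightarrow> 1 - complex_of_real k * z\<^sup>2 \<notin> \<real>\<^sub>\<le>\<^sub>0" by (rule *)
qed

lemma csqrt_one_minus_of_real:
  fixes k t :: real
  assumes "0 \<le> k" "0 < t" "t < 1 / (1 + k)"
  shows "csqrt (1 - complex_of_real k * (complex_of_real t)\<^sup>2) = complex_of_real (sqrt (1 - k * t\<^sup>2))"
    and "k * t\<^sup>2 < 1"
proof -
  show 1: "k * t\<^sup>2 < 1" using square_small[of k t] assms by simp
  have "1 - complex_of_real k * (complex_of_real t)\<^sup>2 = complex_of_real (1 - k * t\<^sup>2)" by simp
  then show "csqrt (1 - complex_of_real k * (complex_of_real t)\<^sup>2) = complex_of_real (sqrt (1 - k * t\<^sup>2))"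
    using 1 by (simp only:) (subst csqrt_of_real_nonneg; simp)
qed

lemma holomorphic_germ_sqrt_one_minus:
  assumes "0 \<le> k"
  shows "holomorphic_germ (\<lambda>t. sqrt (1 - k * t\<^sup>2))"
proof (rule holomorphic_germI)
  show "0 < 1 / (1 + k)" using assms by simp
qed (use csqrt_one_minus_holomorphic(1)[OF assms] csqrt_one_minus_of_real[OF assms] in auto)

text \<open>The substitution \<open>h\<close> is holomorphic near \<open>0\<close>, fixes
  \<open>0\<close> and maps small positive reals to small positive reals, so
  \<open>g \<circ> h\<close> is defined near \<open>0\<close> and represents the new
  function.\<close>

lemma holomorphic_germ_reparam:
  assumes "holomorphic_germ f" "0 \<le> k"
  shows "holomorphic_germ (\<lambda>t. f (t / sqrt (1 - k * t\<^sup>2)))"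
proof -
  obtain \<delta> g where g: "0 < \<delta>" "g holomorphic_on ball 0 \<delta>"
    "\<And>t. 0 < t \<Longrightarrow> t < \<delta> \<Longrightarrow> complex_of_real (f t) = g (complex_of_real t)"
    using assms(1) by (rule holomorphic_germE) blast
  define \<epsilon> where "\<epsilon> = 1 / (1 + k)"
  define h where "h = (\<lambda>z. z / csqrt (1 - complex_of_real k * z\<^sup>2))"
  have \<epsilon>: "0 < \<epsilon>" using assms by (simp add: \<epsilon>_def)
  have h: "h holomorphic_on ball 0 \<epsilon>"
    unfolding h_def \<epsilon>_def
    using csqrt_one_minus_holomorphic(2)[OF assms(2)]
    by (intro holomorphic_on_divide holomorphic_on_ident csqrt_one_minus_holomorphic assms) force+
  then have "continuous_on (ball 0 \<epsilon>) h" by (rule holomorphic_on_imp_continuous_on)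
  then have "isCont h 0" using \<epsilon> by (simp add: continuous_on_eq_continuous_at)
  then obtain \<eta> where \<eta>: "0 < \<eta>" "\<And>z. dist z 0 < \<eta> \<Longrightarrow> dist (h z) (h 0) < \<delta>"
    unfolding continuous_at_eps_delta using g(1) by blast
  have h0: "h 0 = 0" by (simp add: h_def)
  show ?thesis
  proof (rule holomorphic_germI)
    show "0 < min \<eta> \<epsilon>" using \<eta> \<epsilon> by simp
    have "h ` ball 0 (min \<eta> \<epsilon>) \<subseteq> ball 0 \<delta>"
      using \<eta>(2) h0 by (auto simp: dist_norm norm_minus_commute)
    then show "(g \<circ> h) holomorphic_on ball 0 (min \<eta> \<epsilon>)"
      by (intro holomorphic_on_compose_gen[OF _ g(2)] holomorphic_on_subset[OF h]) auto
    fix t :: real assume t: "0 < t" "t < min \<eta> \<epsilon>"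
    have ht: "h (complex_of_real t) = complex_of_real (t / sqrt (1 - k * t\<^sup>2))"
      unfolding h_def using t csqrt_one_minus_of_real[OF assms(2), of t] by (simp add: \<epsilon>_def)
    have kt: "k * t\<^sup>2 < 1" using csqrt_one_minus_of_real(2)[OF assms(2), of t] t by (simp add: \<epsilon>_def)
    have "norm (h (complex_of_real t)) < \<delta>" using \<eta>(2)[of "complex_of_real t"] t h0 by simp
    then have "\<bar>t / sqrt (1 - k * t\<^sup>2)\<bar> < \<delta>" unfolding ht norm_of_real .
    then have "t / sqrt (1 - k * t\<^sup>2) < \<delta>" by linarith
    moreover have "0 < t / sqrt (1 - k * t\<^sup>2)" using t kt by simp
    ultimately show "complex_of_real (f (t / sqrt (1 - k * t\<^sup>2))) = (g \<circ> h) (complex_of_real t)"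
      using g(3) ht by simp
  qed
qed

text \<open>The integral is the real part of the primitive \<open>G\<close> of \<open>g\<close> with
  \<open>G 0 = 0\<close>; \<open>G\<close> is real on the positive axis near \<open>0\<close>
  because \<open>g\<close> is.\<close>

lemma holomorphic_germ_nn_integral:
  assumes H: "holomorphic_germ H" and nonneg: "\<And>s. 0 \<le> H s"
    and meas: "H \<in> borel_measurable borel"
  shows "holomorphic_germ (\<lambda>t. enn2real (\<integral>\<^sup>+s. ennreal (H s) * indicator {0<..t} s \<partial>lborel))"
proof -
  obtain \<delta> g where g: "0 < \<delta>" "g holomorphic_on ball 0 \<delta>"
    "\<And>t. 0 < t \<Longrightarrow> t < \<delta> \<Longrightarrow> complex_of_real (H t) = g (complex_of_real t)"
    using H by (rule holomorphic_germE) blast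
  obtain G0 where G0: "\<And>x. x \<in> ball 0 \<delta> \<Longrightarrow> (G0 has_field_derivative g x) (at x within ball 0 \<delta>)"
    using holomorphic_convex_primitive[of "ball 0 \<delta>" "{}" g] g(2)
    by (auto simp: holomorphic_on_imp_continuous_on holomorphic_on_def field_differentiable_at_within
          field_differentiable_def at_within_open[OF _ open_ball])
  define G where "G = (\<lambda>z. G0 z - G0 0)"
  have G: "(G has_field_derivative g x) (at x)" if "x \<in> ball 0 \<delta>" for x
    unfolding G_def using G0[OF that] that
    by (auto simp: at_within_open[OF _ open_ball] intro!: derivative_eq_intros)
  have G_hol: "G holomorphic_on ball 0 \<delta>"
    by (auto simp: holomorphic_on_open intro: G)
  have dG: "((\<lambda>s. Re (G (complex_of_real s))) has_real_derivative Re (g (complex_of_real s))) (at s)"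
           "((\<lambda>s. Im (G (complex_of_real s))) has_real_derivative Im (g (complex_of_real s))) (at s)"
    if "\<bar>s\<bar> < \<delta>" for s
    using has_vector_derivative_real_field[OF G[of "complex_of_real s"], where s = UNIV] that
    by (auto simp: has_real_derivative_iff_has_vector_derivative
        intro!: bounded_linear.has_vector_derivative[OF bounded_linear_Re]
          bounded_linear.has_vector_derivative[OF bounded_linear_Im])
  have g_cont: "isCont g 0"
    using g(1,2) by (metis centre_in_ball continuous_on_eq_continuous_at holomorphic_on_imp_continuous_on open_ball)
  \<comment> \<open>\<open>H\<close> and \<open>g\<close> are related only to the right of
    \<open>0\<close>, so the sign of \<open>g\<close> at \<open>0\<close> comes from a
    limit.\<close>
  have g0: "0 \<le> Re (g 0)"
  proof (rule tendsto_lowerbound)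
    have "filterlim complex_of_real (nhds 0) (at_right 0)"
      by (intro filterlim_mono[OF tendsto_of_real[OF tendsto_ident_at]]) auto
    then have "((\<lambda>s. g (complex_of_real s)) \<longlongrightarrow> g 0) (at_right 0)"
      by (rule isCont_tendsto_compose[OF g_cont])
    then show "((\<lambda>s. Re (g (complex_of_real s))) \<longlongrightarrow> Re (g 0)) (at_right 0)"
      by (rule tendsto_Re)
    show "\<forall>\<^sub>F s in at_right 0. 0 \<le> Re (g (complex_of_real s))"
      unfolding eventually_at_right_field using g(1) g(3)[symmetric] nonneg by (intro exI[of _ \<delta>]) simp
  qed simp
  show ?thesis
  proof (rule holomorphic_germI[OF g(1) G_hol])
    fix t assume t: "0 < t" "t < \<delta>"
    have Gt: "continuous_on {0..t} (\<lambda>s. Im (G (complex_of_real s)))"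
      by (rule DERIV_continuous_on[where D = "\<lambda>s. Im (g (complex_of_real s))"])
         (use t in \<open>auto intro!: has_field_derivative_at_within[OF dG(2)]\<close>)
    have "Im (G (complex_of_real t)) = Im (G (complex_of_real 0))"
    proof (rule DERIV_isconst_end[OF t(1) Gt])
      fix s assume s: "0 < s" "s < t"
      then have "Im (g (complex_of_real s)) = 0" using g(3)[of s, symmetric] t by simp
      then show "((\<lambda>s. Im (G (complex_of_real s))) has_real_derivative 0) (at s)"
        using dG(2)[of s] s t by simp
    qed
    then have Im0: "Im (G (complex_of_real t)) = 0" by (simp add: G_def)
    \<comment> \<open>The fundamental theorem is applied on the closed interval, so the value of
      \<open>H\<close> at \<open>0\<close> is replaced by that of \<open>g\<close>; one point does
      not affect the integral.\<close>
    define h where "h = (\<lambda>s. if s = 0 then Re (g 0) else H s)"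
    have h_eq: "h s = Re (g (complex_of_real s))" if "0 \<le> s" "s \<le> t" for s
      using that t g(3)[of s, symmetric] by (auto simp: h_def)
    have [measurable]: "h \<in> borel_measurable borel" unfolding h_def using meas by measurable
    have "(\<integral>\<^sup>+s. ennreal (H s) * indicator {0<..t} s \<partial>lborel) =
        (\<integral>\<^sup>+s. ennreal (h s) * indicator {0..t} s \<partial>lborel)"
      using AE_lborel_singleton[of "0::real"]
      by (intro nn_integral_cong_AE, elim AE_mp, intro AE_I2) (auto simp: h_def indicator_def)
    also have "\<dots> = ennreal (Re (G (complex_of_real t)) - Re (G (complex_of_real 0)))"
    proof (rule nn_integral_FTC_Icc)
      fix s assume s: "s \<in> {0..t}"
      show "((\<lambda>s. Re (G (complex_of_real s))) has_real_derivative h s) (at s)"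
        using dG(1)[of s] s t by (simp add: h_eq)
      show "0 \<le> h s" using nonneg g0 by (simp add: h_def)
    qed (use t in auto)
    finally have eq: "(\<integral>\<^sup>+s. ennreal (H s) * indicator {0<..t} s \<partial>lborel) = ennreal (Re (G (complex_of_real t)))"
      by (simp add: G_def)
    have "0 \<le> Re (G (complex_of_real t))"
    proof -
      have "Re (G (complex_of_real 0)) \<le> Re (G (complex_of_real t))"
      proof (rule DERIV_nonneg_imp_nondecreasing[where f = "\<lambda>s. Re (G (complex_of_real s))"])
        fix s assume s: "0 \<le> s" "s \<le> t"
        have "0 \<le> h s" using nonneg g0 by (simp add: h_def)
        then have "0 \<le> Re (g (complex_of_real s))" unfolding h_eq[OF s] .
        then show "\<exists>y. ((\<lambda>s. Re (G (complex_of_real s))) has_real_derivative y) (at s) \<and> 0 \<le> y"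
          using dG(1)[of s] s t by auto
      qed (use t in auto)
      then show ?thesis by (simp add: G_def)
    qed
    then show "complex_of_real (enn2real (\<integral>\<^sup>+s. ennreal (H s) * indicator {0<..t} s \<partial>lborel))
        = G (complex_of_real t)"
      unfolding eq using Im0 by (simp add: complex_eq_iff)
  qed
qed

section \<open>Lebesgue measure on finite products\<close>

text \<open>With coordinates indexed by a set, passing to a facet deletes one index, and the
  induction on dimension never changes a type.\<close>

abbreviation lebesgue_PiM :: "'i set \<Rightarrow> ('i \<Rightarrow> real) measure" where
  "lebesgue_PiM I \<equiv> PiM I (\<lambda>_. lborel)"

lemma product_sigma_finite_lborel: "product_sigma_finite (\<lambda>_::'i. lborel :: real measure)"
  by standard

lemma sigma_finite_lebesgue_PiM: "finite I \<Longrightarrow> sigma_finite_measure (lebesgue_PiM I)"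
  by (rule product_sigma_finite.sigma_finite[OF product_sigma_finite_lborel])

lemma nn_integral_lebesgue_PiM_insert:
  assumes "finite I" "j \<notin> I" "h \<in> borel_measurable (lebesgue_PiM (insert j I))"
  shows "(\<integral>\<^sup>+x. h x \<partial>lebesgue_PiM (insert j I)) =
    (\<integral>\<^sup>+x. \<integral>\<^sup>+s. h (x(j := s)) \<partial>lborel \<partial>lebesgue_PiM I)"
  using product_sigma_finite.product_nn_integral_insert[OF product_sigma_finite_lborel assms] .

text \<open>Each coordinate contributes one factor \<open>c\<close> by the one-dimensional
  substitution. This later brings a shrunken, shifted ball back to the unit ball.\<close>

lemma nn_integral_lebesgue_PiM_affine:
  assumes "finite I" "c > 0" "h \<in> borel_measurable (lebesgue_PiM I)"
  shows "(\<integral>\<^sup>+x. h x \<partial>lebesgue_PiM I) =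
    ennreal (c ^ card I) * (\<integral>\<^sup>+x. h (\<lambda>i\<in>I. y i + c * x i) \<partial>lebesgue_PiM I)"
  using assms(1,3)
proof (induction I arbitrary: h rule: finite_induct)
  case empty
  then show ?case by (simp add: product_sigma_finite.nn_integral_empty[OF product_sigma_finite_lborel] space_PiM)
next
  case (insert j I)
  note [measurable] = insert.prems
  interpret sigma_finite_measure "lebesgue_PiM I" by (rule sigma_finite_lebesgue_PiM) fact
  have "(\<integral>\<^sup>+x. h x \<partial>lebesgue_PiM (insert j I)) =
      (\<integral>\<^sup>+x. \<integral>\<^sup>+s. h (x(j := s)) \<partial>lborel \<partial>lebesgue_PiM I)"
    by (rule nn_integral_lebesgue_PiM_insert) (use insert in auto)
  also have "\<dots> = (\<integral>\<^sup>+x. ennreal c * (\<integral>\<^sup>+s. h (x(j := y j + c * s)) \<partial>lborel) \<partial>lebesgue_PiM I)"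
  proof (rule nn_integral_cong)
    fix x assume "x \<in> space (lebesgue_PiM I)"
    then have [measurable]: "(\<lambda>s. h (x(j := s))) \<in> borel_measurable borel"
      using \<open>j \<notin> I\<close> by measurable
    show "(\<integral>\<^sup>+s. h (x(j := s)) \<partial>lborel) = ennreal c * (\<integral>\<^sup>+s. h (x(j := y j + c * s)) \<partial>lborel)"
      by (subst nn_integral_real_affine[where c = c and t = "y j"]) (use assms(2) in auto)
  qed
  also have "\<dots> = ennreal c * (\<integral>\<^sup>+x. \<integral>\<^sup>+s. h (x(j := y j + c * s)) \<partial>lborel \<partial>lebesgue_PiM I)"
    by (rule nn_integral_cmult) measurable
  also have "(\<integral>\<^sup>+x. \<integral>\<^sup>+s. h (x(j := y j + c * s)) \<partial>lborel \<partial>lebesgue_PiM I) =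
     ennreal (c ^ card I) *
       (\<integral>\<^sup>+x. \<integral>\<^sup>+s. h ((\<lambda>i\<in>I. y i + c * x i)(j := y j + c * s)) \<partial>lborel \<partial>lebesgue_PiM I)"
    by (rule insert.IH) measurable
  also have "(\<integral>\<^sup>+x. \<integral>\<^sup>+s. h ((\<lambda>i\<in>I. y i + c * x i)(j := y j + c * s)) \<partial>lborel \<partial>lebesgue_PiM I) =
      (\<integral>\<^sup>+x. \<integral>\<^sup>+s. h (\<lambda>i\<in>insert j I. y i + c * (x(j := s)) i) \<partial>lborel \<partial>lebesgue_PiM I)"
    using \<open>j \<notin> I\<close>
    by (intro nn_integral_cong arg_cong[where f = h]) (auto simp: fun_eq_iff restrict_def)
  also have "\<dots> = (\<integral>\<^sup>+x. h (\<lambda>i\<in>insert j I. y i + c * x i) \<partial>lebesgue_PiM (insert j I))"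
    by (rule nn_integral_lebesgue_PiM_insert[symmetric]) (use insert in auto)
  also have "ennreal c * (ennreal (c ^ card I) * \<dots>) = ennreal (c ^ card (insert j I)) * \<dots>"
    using insert assms(2) by (simp add: ennreal_mult mult.assoc)
  finally show ?case .
qed

text \<open>The coordinate \<open>x j\<close> is exchanged for the value \<open>s\<close> of the
  functional \<open>\<phi>\<close>. With the other coordinates fixed this is affine with slope
  \<open>1 / \<phi> j\<close>, hence the factor; Fubini then makes \<open>s\<close> the outer
  variable.\<close>

lemma nn_integral_lebesgue_PiM_slice:
  assumes "finite I" "j \<in> I" "\<phi> j \<noteq> 0" and [measurable]: "h \<in> borel_measurable (lebesgue_PiM I)"
  shows "(\<integral>\<^sup>+x. h x \<partial>lebesgue_PiM I) = ennreal (1 / \<bar>\<phi> j\<bar>) *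
    (\<integral>\<^sup>+s. \<integral>\<^sup>+x. h (x(j := (s - (\<Sum>i\<in>I - {j}. \<phi> i * x i)) / \<phi> j)) \<partial>lebesgue_PiM (I - {j}) \<partial>lborel)"
proof -
  define J where "J = I - {j}"
  have J: "I = insert j J" "j \<notin> J" "finite J" using assms by (auto simp: J_def)
  note [measurable] = assms(4)[unfolded J(1)]
  interpret sigma_finite_measure "lebesgue_PiM J" by (rule sigma_finite_lebesgue_PiM) fact
  interpret pair_sigma_finite "lebesgue_PiM J" "lborel :: real measure" ..
  have "(\<integral>\<^sup>+x. h x \<partial>lebesgue_PiM I) =
      (\<integral>\<^sup>+x. \<integral>\<^sup>+s. h (x(j := s)) \<partial>lborel \<partial>lebesgue_PiM J)"
    unfolding J(1) by (rule nn_integral_lebesgue_PiM_insert) (use J in auto)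
  also have "\<dots> = (\<integral>\<^sup>+x. ennreal (1 / \<bar>\<phi> j\<bar>) *
      (\<integral>\<^sup>+s. h (x(j := (s - (\<Sum>i\<in>J. \<phi> i * x i)) / \<phi> j)) \<partial>lborel) \<partial>lebesgue_PiM J)"
  proof (rule nn_integral_cong)
    fix x assume "x \<in> space (lebesgue_PiM J)"
    then have [measurable]: "(\<lambda>s. h (x(j := s))) \<in> borel_measurable borel"
      using J by measurable
    show "(\<integral>\<^sup>+s. h (x(j := s)) \<partial>lborel) =
       ennreal (1 / \<bar>\<phi> j\<bar>) * (\<integral>\<^sup>+s. h (x(j := (s - (\<Sum>i\<in>J. \<phi> i * x i)) / \<phi> j)) \<partial>lborel)"
      by (subst nn_integral_real_affine[where c = "1 / \<phi> j" and t = "- (\<Sum>i\<in>J. \<phi> i * x i) / \<phi> j"])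
         (use assms(3) in \<open>auto simp: diff_divide_distrib\<close>)
  qed
  also have "\<dots> = ennreal (1 / \<bar>\<phi> j\<bar>) *
      (\<integral>\<^sup>+x. \<integral>\<^sup>+s. h (x(j := (s - (\<Sum>i\<in>J. \<phi> i * x i)) / \<phi> j)) \<partial>lborel \<partial>lebesgue_PiM J)"
    by (rule nn_integral_cmult) measurable
  also have "(\<integral>\<^sup>+x. \<integral>\<^sup>+s. h (x(j := (s - (\<Sum>i\<in>J. \<phi> i * x i)) / \<phi> j)) \<partial>lborel \<partial>lebesgue_PiM J) =
      (\<integral>\<^sup>+s. \<integral>\<^sup>+x. h (x(j := (s - (\<Sum>i\<in>J. \<phi> i * x i)) / \<phi> j)) \<partial>lebesgue_PiM J \<partial>lborel)"
    by (rule Fubini'[symmetric]) measurable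
  finally show ?thesis by (simp add: J_def)
qed

text \<open>Sliced along \<open>\<phi>\<close> itself, the hyperplane lives only over
  \<open>s = b\<close>, a single point.\<close>

lemma AE_lebesgue_PiM_hyperplane:
  assumes "finite I" "j \<in> I" "\<phi> j \<noteq> 0"
  shows "AE x in lebesgue_PiM I. (\<Sum>i\<in>I. \<phi> i * x i) \<noteq> b"
proof -
  let ?S = "{x \<in> space (lebesgue_PiM I). (\<Sum>i\<in>I. \<phi> i * x i) = b}"
  have S[measurable]: "?S \<in> sets (lebesgue_PiM I)" by measurable
  have val: "(\<Sum>i\<in>I. \<phi> i * (x(j := (s - (\<Sum>i\<in>I - {j}. \<phi> i * x i)) / \<phi> j)) i) = s" for x s
    using assms by (subst sum.remove[of I j]) auto
  have "emeasure (lebesgue_PiM I) ?S = (\<integral>\<^sup>+x. indicator ?S x \<partial>lebesgue_PiM I)" by simp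
  also have "\<dots> = ennreal (1 / \<bar>\<phi> j\<bar>) * (\<integral>\<^sup>+s. \<integral>\<^sup>+x. indicator ?S
      (x(j := (s - (\<Sum>i\<in>I - {j}. \<phi> i * x i)) / \<phi> j)) \<partial>lebesgue_PiM (I - {j}) \<partial>lborel)"
    by (rule nn_integral_lebesgue_PiM_slice) (use assms in auto)
  also have "(\<integral>\<^sup>+s. \<integral>\<^sup>+x. indicator ?S
      (x(j := (s - (\<Sum>i\<in>I - {j}. \<phi> i * x i)) / \<phi> j)) \<partial>lebesgue_PiM (I - {j}) \<partial>lborel) =
      (\<integral>\<^sup>+(s::real). 0 \<partial>lborel)"
    using AE_lborel_singleton[of b]
    by (intro nn_integral_cong_AE, elim AE_mp, intro AE_I2)
       (auto simp: indicator_def val simp del: fun_upd_apply)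
  finally have "emeasure (lebesgue_PiM I) ?S = 0" by simp
  then have "AE x in lebesgue_PiM I. x \<notin> ?S" by (intro AE_not_in) (simp add: null_sets_def S)
  then show ?thesis by (rule AE_mp) auto
qed

section \<open>Scaled polyhedral sections of ellipsoids\<close>

text \<open>For finite \<open>I\<close> this is linear independence of the family \<open>v\<close>,
  in a quantitative form that bounds regions directly and passes to facets with the same
  \<open>B\<close>.\<close>

definition coercive :: "'i set \<Rightarrow> ('i \<Rightarrow> 'a::real_normed_vector) \<Rightarrow> bool" where
  "coercive I v \<longleftrightarrow> (\<exists>B. \<forall>x. \<forall>i\<in>I. \<bar>x i\<bar> \<le> B * norm (\<Sum>i\<in>I. x i *\<^sub>R v i))"

text \<open>The drift \<open>t *\<^sub>R w\<close> is there for facets: they lie in hyperplanes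
  whose distance from the origin is proportional to \<open>t\<close>. Constraints are functionals of
  the coefficients, so that a facet is again a region of this form.\<close>

definition scaled_region ::
  "'i set \<Rightarrow> ('i \<Rightarrow> 'a::euclidean_space) \<Rightarrow> (('i \<Rightarrow> real) \<times> real) set \<Rightarrow> 'a \<Rightarrow> real \<Rightarrow> ('i \<Rightarrow> real) set"
where
  "scaled_region I v A w t = {x \<in> space (lebesgue_PiM I).
     norm (t *\<^sub>R w + (\<Sum>i\<in>I. x i *\<^sub>R v i)) \<le> 1 \<and> (\<forall>(\<phi>, b)\<in>A. (\<Sum>i\<in>I. \<phi> i * x i) \<le> t * b)}"

lemma sets_lebesgue_PiM_constraints [measurable]:
  assumes "finite A" "finite I"
  shows "{x \<in> space (lebesgue_PiM I). \<forall>(\<phi>, b)\<in>A. (\<Sum>i\<in>I. \<phi> i * x i) \<le> t * b} \<in> sets (lebesgue_PiM I)"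
  unfolding case_prod_beta
  by (rule sets.sets_Collect_finite_All[OF _ assms(1)]) measurable

lemma scaled_region_sets:
  assumes "finite A" "finite I"
  shows "scaled_region I v A w t \<in> sets (lebesgue_PiM I)"
proof -
  have "scaled_region I v A w t =
      {x \<in> space (lebesgue_PiM I). norm (t *\<^sub>R w + (\<Sum>i\<in>I. x i *\<^sub>R v i)) \<le> 1} \<inter>
      {x \<in> space (lebesgue_PiM I). \<forall>(\<phi>, b)\<in>A. (\<Sum>i\<in>I. \<phi> i * x i) \<le> t * b}"
    by (auto simp: scaled_region_def)
  also have "\<dots> \<in> sets (lebesgue_PiM I)"
    by (intro sets.Int sets_lebesgue_PiM_constraints assms) measurable
  finally show ?thesis .
qed

text \<open>Coercivity encloses \<open>S\<close> in a box.\<close>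

lemma fmeasurable_coercive:
  assumes "coercive I v" "finite I" "S \<in> sets (lebesgue_PiM I)"
    and bd: "\<And>x. x \<in> S \<Longrightarrow> norm (\<Sum>i\<in>I. x i *\<^sub>R v i) \<le> C"
  shows "S \<in> fmeasurable (lebesgue_PiM I)"
proof -
  obtain B where B: "\<And>x i. i \<in> I \<Longrightarrow> \<bar>x i\<bar> \<le> B * norm (\<Sum>i\<in>I. x i *\<^sub>R v i)"
    using assms(1) unfolding coercive_def by blast
  define D where "D = \<bar>B\<bar> * \<bar>C\<bar>"
  have le: "\<bar>x i\<bar> \<le> D" if "x \<in> S" "i \<in> I" for x i
  proof -
    have "\<bar>x i\<bar> \<le> \<bar>B\<bar> * norm (\<Sum>i\<in>I. x i *\<^sub>R v i)"
      using B[of i x] that by (smt (verit) mult_right_mono norm_ge_zero)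
    also have "\<dots> \<le> D" unfolding D_def using bd[OF that(1)] by (intro mult_left_mono) auto
    finally show ?thesis .
  qed
  let ?box = "Pi\<^sub>E I (\<lambda>_. {- D..D})"
  have "emeasure (lebesgue_PiM I) ?box = (\<Prod>i\<in>I. emeasure lborel {- D..D})"
    by (rule product_sigma_finite.emeasure_PiM[OF product_sigma_finite_lborel assms(2)]) auto
  also have "\<dots> < \<infinity>"
    by (simp add: emeasure_lborel_Icc_eq power_less_top_ennreal)
  finally have "?box \<in> fmeasurable (lebesgue_PiM I)"
    using assms(2) by (intro fmeasurableI sets_PiM_I_finite) auto
  moreover have "S \<subseteq> ?box"
  proof
    fix x assume x: "x \<in> S"
    then have "x \<in> space (lebesgue_PiM I)" using sets.sets_into_space[OF assms(3)] by blast
    then show "x \<in> ?box" using le[OF x] by (auto simp: space_PiM PiE_iff abs_le_iff minus_le_iff)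
  qed
  ultimately show ?thesis using assms(3) by (rule fmeasurableI2)
qed

lemma scaled_region_fmeasurable:
  assumes "coercive I v" "finite I" "finite A"
  shows "scaled_region I v A w t \<in> fmeasurable (lebesgue_PiM I)"
proof (rule fmeasurable_coercive[OF assms(1,2) scaled_region_sets[OF assms(3,2)]])
  fix x assume "x \<in> scaled_region I v A w t"
  then have "norm (t *\<^sub>R w + (\<Sum>i\<in>I. x i *\<^sub>R v i)) \<le> 1" by (simp add: scaled_region_def)
  then show "norm (\<Sum>i\<in>I. x i *\<^sub>R v i) \<le> 1 + norm (t *\<^sub>R w)"
    using norm_triangle_ineq4[of "t *\<^sub>R w + (\<Sum>i\<in>I. x i *\<^sub>R v i)" "t *\<^sub>R w"] by simp
qed

section \<open>Removing the drift \<open>w\<close>\<close>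

lemma lincomb_orthogonal_decomp:
  fixes v :: "'i \<Rightarrow> 'a::euclidean_space"
  assumes "finite I"
  obtains y z where "w = (\<Sum>i\<in>I. y i *\<^sub>R v i) + z" "\<And>i. i \<in> I \<Longrightarrow> z \<bullet> v i = 0"
proof -
  obtain u z where uz: "u \<in> span (v ` I)" "\<And>x. x \<in> span (v ` I) \<Longrightarrow> orthogonal z x" "w = u + z"
    using orthogonal_subspace_decomp_exists by blast
  let ?S = "range (\<lambda>y. \<Sum>i\<in>I. y i *\<^sub>R v i)"
  have "subspace ?S"
  proof (rule subspaceI)
    show "0 \<in> ?S" by (rule image_eqI[of _ _ "\<lambda>_. 0"]) auto
    fix x y assume "x \<in> ?S" "y \<in> ?S"
    then obtain a b where ab: "x = (\<Sum>i\<in>I. a i *\<^sub>R v i)" "y = (\<Sum>i\<in>I. b i *\<^sub>R v i)" by auto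
    show "x + y \<in> ?S"
      by (rule image_eqI[of _ _ "\<lambda>i. a i + b i"]) (auto simp: ab scaleR_left_distrib sum.distrib)
    show "c *\<^sub>R x \<in> ?S" for c
      by (rule image_eqI[of _ _ "\<lambda>i. c * a i"]) (auto simp: ab scaleR_sum_right)
  qed
  moreover have "v ` I \<subseteq> ?S"
  proof
    fix x assume "x \<in> v ` I"
    then obtain j where j: "j \<in> I" "x = v j" by auto
    then show "x \<in> ?S" using assms
      by (intro image_eqI[of _ _ "\<lambda>i. if i = j then 1 else 0"]) (auto simp: if_distrib[of "\<lambda>c. c *\<^sub>R _"] cong: if_cong)
  qed
  ultimately have "u \<in> ?S" using uz(1) span_minimal by blast
  then obtain y where "u = (\<Sum>i\<in>I. y i *\<^sub>R v i)" by auto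
  moreover have "z \<bullet> v i = 0" if "i \<in> I" for i
    using uz(2)[of "v i"] that by (simp add: span_base orthogonal_def)
  ultimately show ?thesis using that uz(3) by blast
qed

text \<open>The part of \<open>w\<close> in the span of \<open>v\<close> is absorbed by shifting
  coordinates. By Pythagoras the orthogonal part \<open>z\<close> shrinks the radius to
  \<open>\<rho> = sqrt (1 - k * t\<^sup>2)\<close>; dividing by \<open>\<rho>\<close> gives a
  driftless region at time \<open>t / \<rho>\<close>, with volume factor
  \<open>\<rho> ^ card I\<close>.\<close>

lemma holomorphic_germ_scaled_region_shift:
  fixes v :: "'i \<Rightarrow> 'a::euclidean_space"
  assumes I: "finite I" and A: "finite A"
    and germ: "\<And>A. finite A \<Longrightarrow> holomorphic_germ (\<lambda>t. measure (lebesgue_PiM I) (scaled_region I v A 0 t))"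
  shows "holomorphic_germ (\<lambda>t. measure (lebesgue_PiM I) (scaled_region I v A w t))"
proof -
  obtain y z where yz: "w = (\<Sum>i\<in>I. y i *\<^sub>R v i) + z" "\<And>i. i \<in> I \<Longrightarrow> z \<bullet> v i = 0"
    using lincomb_orthogonal_decomp[OF I] by blast
  define k where "k = (norm z)\<^sup>2"
  have k: "0 \<le> k" by (simp add: k_def)
  \<comment> \<open>The shift by \<open>- t * y\<close> changes the value of \<open>\<phi>\<close>
    by a multiple of \<open>t\<close>, which joins \<open>t * b\<close> on the right-hand
    side.\<close>
  define A' where "A' = (\<lambda>(\<phi>, b). (\<phi>, b + (\<Sum>i\<in>I. \<phi> i * y i))) ` A"
  have A': "finite A'" using A by (simp add: A'_def)
  show ?thesis
  proof (rule holomorphic_germ_cong)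
    show "holomorphic_germ (\<lambda>t. sqrt (1 - k * t\<^sup>2) ^ card I *
        measure (lebesgue_PiM I) (scaled_region I v A' 0 (t / sqrt (1 - k * t\<^sup>2))))"
      by (intro holomorphic_germ_mult holomorphic_germ_power holomorphic_germ_sqrt_one_minus k
          holomorphic_germ_reparam[OF germ] A')
    show "0 < 1 / (1 + k)" using k by simp
    fix t :: real assume t: "0 < t" "t < 1 / (1 + k)"
    define \<rho> where "\<rho> = sqrt (1 - k * t\<^sup>2)"
    have kt: "k * t\<^sup>2 < 1" by (rule csqrt_one_minus_of_real(2)[OF k t])
    then have \<rho>: "0 < \<rho>" "\<rho>\<^sup>2 = 1 - k * t\<^sup>2" by (auto simp: \<rho>_def)
    have eq: "(\<lambda>i\<in>I. - t * y i + \<rho> * u i) \<in> scaled_region I v A w t \<longleftrightarrow> u \<in> scaled_region I v A' 0 (t / \<rho>)"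
      if u: "u \<in> space (lebesgue_PiM I)" for u
    proof -
      let ?x = "\<lambda>i\<in>I. - t * y i + \<rho> * u i" and ?T = "\<lambda>x. \<Sum>i\<in>I. x i *\<^sub>R v i"
      have "t *\<^sub>R w + ?T ?x = t *\<^sub>R z + \<rho> *\<^sub>R ?T u"
        by (simp add: yz(1) scaleR_left_distrib scaleR_right_distrib sum.distrib scaleR_sum_right
            sum_negf scaleR_diff_left sum_subtractf)
      moreover have "(t *\<^sub>R z) \<bullet> (\<rho> *\<^sub>R ?T u) = 0" by (simp add: inner_sum_right yz(2))
      ultimately have "(norm (t *\<^sub>R w + ?T ?x))\<^sup>2 = k * t\<^sup>2 + \<rho>\<^sup>2 * (norm (?T u))\<^sup>2"
        using norm_add_Pythagorean[of "t *\<^sub>R z" "\<rho> *\<^sub>R ?T u"]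
        by (simp add: orthogonal_def k_def power_mult_distrib mult.commute del: inner_scaleR_left inner_scaleR_right)
      then have "norm (t *\<^sub>R w + ?T ?x) \<le> 1 \<longleftrightarrow> k * t\<^sup>2 + \<rho>\<^sup>2 * (norm (?T u))\<^sup>2 \<le> 1"
        using abs_square_le_1[of "norm (t *\<^sub>R w + ?T ?x)"] by simp
      also have "\<dots> \<longleftrightarrow> \<rho>\<^sup>2 * (norm (?T u))\<^sup>2 \<le> \<rho>\<^sup>2 * 1" by (simp add: \<rho>(2) algebra_simps)
      also have "\<dots> \<longleftrightarrow> (norm (?T u))\<^sup>2 \<le> 1" using \<rho>(1) by (subst mult_le_cancel_left_pos) auto
      also have "\<dots> \<longleftrightarrow> norm (?T u) \<le> 1" using abs_square_le_1[of "norm (?T u)"] by simp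
      finally have 1: "norm (t *\<^sub>R w + ?T ?x) \<le> 1 \<longleftrightarrow> norm (?T u) \<le> 1" .
      have 2: "(\<Sum>i\<in>I. \<phi> i * ?x i) \<le> t * b \<longleftrightarrow>
          (\<Sum>i\<in>I. \<phi> i * u i) \<le> t / \<rho> * (b + (\<Sum>i\<in>I. \<phi> i * y i))" for \<phi> b
      proof -
        have *: "(\<Sum>i\<in>I. \<phi> i * ?x i) = - t * (\<Sum>i\<in>I. \<phi> i * y i) + \<rho> * (\<Sum>i\<in>I. \<phi> i * u i)"
          by (simp add: sum_distrib_left sum.distrib[symmetric] algebra_simps sum_negf sum_subtractf)
        show ?thesis unfolding * using \<rho>(1) by (simp add: field_simps)
      qed
      have "?x \<in> space (lebesgue_PiM I)" by (simp add: space_PiM)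
      then show ?thesis using u 1 2 by (auto simp: scaled_region_def A'_def)
    qed
    have [measurable]: "scaled_region I v A w t \<in> sets (lebesgue_PiM I)" by (rule scaled_region_sets[OF A I])
    have "emeasure (lebesgue_PiM I) (scaled_region I v A w t) =
        (\<integral>\<^sup>+x. indicator (scaled_region I v A w t) x \<partial>lebesgue_PiM I)" by simp
    also have "\<dots> = ennreal (\<rho> ^ card I) *
        (\<integral>\<^sup>+u. indicator (scaled_region I v A w t) (\<lambda>i\<in>I. - t * y i + \<rho> * u i) \<partial>lebesgue_PiM I)"
      by (rule nn_integral_lebesgue_PiM_affine[OF I \<rho>(1)]) measurable
    also have "(\<integral>\<^sup>+u. indicator (scaled_region I v A w t) (\<lambda>i\<in>I. - t * y i + \<rho> * u i) \<partial>lebesgue_PiM I) =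
        (\<integral>\<^sup>+u. indicator (scaled_region I v A' 0 (t / \<rho>)) u \<partial>lebesgue_PiM I)"
      by (rule nn_integral_cong) (simp only: indicator_def eq)
    also have "\<dots> = emeasure (lebesgue_PiM I) (scaled_region I v A' 0 (t / \<rho>))"
      by (simp add: scaled_region_sets[OF A' I])
    finally show "measure (lebesgue_PiM I) (scaled_region I v A w t) = sqrt (1 - k * t\<^sup>2) ^ card I *
        measure (lebesgue_PiM I) (scaled_region I v A' 0 (t / sqrt (1 - k * t\<^sup>2)))"
      using \<rho>(1) by (simp add: measure_def enn2real_mult \<rho>_def)
  qed
qed

section \<open>Restriction to a moving hyperplane\<close>

text \<open>On the hyperplane where \<open>\<phi>\<close> has value \<open>s\<close>, solved for
  coordinate \<open>j\<close>, a functional \<open>\<psi>\<close> becomes one of the remaining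
  coordinates plus a pure multiple of \<open>s\<close>. Hence a constraint with bound
  \<open>s * b\<close> keeps its shape.\<close>

lemma sum_fun_upd_slice:
  fixes \<psi> \<phi> x :: "'i \<Rightarrow> real"
  assumes "finite I" "j \<in> I"
  shows "(\<Sum>i\<in>I. \<psi> i * (x(j := (s - (\<Sum>i\<in>I - {j}. \<phi> i * x i)) / \<phi> j)) i) =
    (\<Sum>i\<in>I - {j}. (\<psi> i - \<psi> j / \<phi> j * \<phi> i) * x i) + s * (\<psi> j / \<phi> j)"
proof -
  have "(\<Sum>i\<in>I. \<psi> i * (x(j := (s - (\<Sum>i\<in>I - {j}. \<phi> i * x i)) / \<phi> j)) i) =
      \<psi> j * ((s - (\<Sum>i\<in>I - {j}. \<phi> i * x i)) / \<phi> j) + (\<Sum>i\<in>I - {j}. \<psi> i * x i)"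
    using assms by (subst sum.remove[of I j]) auto
  also have "\<psi> j * ((s - (\<Sum>i\<in>I - {j}. \<phi> i * x i)) / \<phi> j) =
      s * (\<psi> j / \<phi> j) - \<psi> j / \<phi> j * (\<Sum>i\<in>I - {j}. \<phi> i * x i)"
    by (simp add: algebra_simps diff_divide_distrib)
  finally show ?thesis
    by (simp add: left_diff_distrib sum_subtractf sum_distrib_left mult.assoc)
qed

text \<open>The same elimination for the vector combination: it produces the spanning vectors of the
  facet and its drift \<open>v j /\<^sub>R \<phi> j\<close>.\<close>

lemma sum_scaleR_fun_upd_slice:
  fixes \<phi> x :: "'i \<Rightarrow> real" and v :: "'i \<Rightarrow> 'a::real_vector"
  assumes "finite I" "j \<in> I"
  shows "(\<Sum>i\<in>I. (x(j := (s - (\<Sum>i\<in>I - {j}. \<phi> i * x i)) / \<phi> j)) i *\<^sub>R v i) =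
    s *\<^sub>R (v j /\<^sub>R \<phi> j) + (\<Sum>i\<in>I - {j}. x i *\<^sub>R (v i - (\<phi> i / \<phi> j) *\<^sub>R v j))"
proof -
  have "(\<Sum>i\<in>I. (x(j := (s - (\<Sum>i\<in>I - {j}. \<phi> i * x i)) / \<phi> j)) i *\<^sub>R v i) =
      ((s - (\<Sum>i\<in>I - {j}. \<phi> i * x i)) / \<phi> j) *\<^sub>R v j + (\<Sum>i\<in>I - {j}. x i *\<^sub>R v i)"
    using assms by (subst sum.remove[of I j]) auto
  also have "((s - (\<Sum>i\<in>I - {j}. \<phi> i * x i)) / \<phi> j) *\<^sub>R v j =
      s *\<^sub>R (v j /\<^sub>R \<phi> j) - (\<Sum>i\<in>I - {j}. (x i * (\<phi> i / \<phi> j)) *\<^sub>R v j)"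
  proof -
    have "(\<Sum>i\<in>I - {j}. x i * (\<phi> i / \<phi> j)) = (\<Sum>i\<in>I - {j}. \<phi> i * x i) / \<phi> j"
      by (simp add: sum_divide_distrib mult.commute)
    then show ?thesis
      by (simp add: scaleR_sum_left[symmetric] scaleR_diff_left[symmetric] diff_divide_distrib divide_inverse
          left_diff_distrib)
  qed
  finally show ?thesis
    by (simp add: scaleR_diff_right sum_subtractf)
qed

text \<open>At \<open>s = 0\<close> the slice has no drift, so its combinations are combinations of
  \<open>v\<close> and the bound \<open>B\<close> is inherited.\<close>

lemma coercive_slice:
  assumes "coercive I v" "finite I" "j \<in> I"
  shows "coercive (I - {j}) (\<lambda>i. v i - (\<phi> i / \<phi> j) *\<^sub>R v j)"
proof -
  obtain B where B: "\<And>x i. i \<in> I \<Longrightarrow> \<bar>x i\<bar> \<le> B * norm (\<Sum>i\<in>I. x i *\<^sub>R v i)"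
    using assms(1) unfolding coercive_def by blast
  show ?thesis
    unfolding coercive_def
  proof (intro exI allI ballI)
    fix x i assume "i \<in> I - {j}"
    then show "\<bar>x i\<bar> \<le> B * norm (\<Sum>i\<in>I - {j}. x i *\<^sub>R (v i - (\<phi> i / \<phi> j) *\<^sub>R v j))"
      using B[of i "x(j := (0 - (\<Sum>i\<in>I - {j}. \<phi> i * x i)) / \<phi> j)"]
      unfolding sum_scaleR_fun_upd_slice[OF assms(2,3)] by simp
  qed
qed

text \<open>Sliced along \<open>\<phi>\<close>, the piece has as fibre over \<open>s\<close> the
  facet at time \<open>s\<close>, a region with one index less and a drift. Its volume
  \<open>H\<close> has a holomorphic germ by the hypothesis for \<open>I - {j}\<close> once the
  drift is removed, and the piece has volume \<open>1 / \<bar>\<phi> j\<bar>\<close> times the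
  integral of \<open>H\<close>.\<close>

lemma holomorphic_germ_facet_piece:
  fixes v :: "'i \<Rightarrow> 'a::euclidean_space"
  assumes I: "finite I" and A: "finite A" and v: "coercive I v" and j: "j \<in> I" "\<phi> j \<noteq> 0"
    and germ: "\<And>(v :: 'i \<Rightarrow> 'a) A. coercive (I - {j}) v \<Longrightarrow> finite A \<Longrightarrow>
      holomorphic_germ (\<lambda>t. measure (lebesgue_PiM (I - {j})) (scaled_region (I - {j}) v A 0 t))"
  shows "holomorphic_germ (\<lambda>t. measure (lebesgue_PiM I)
    {x \<in> scaled_region I v A 0 (\<Sum>i\<in>I. \<phi> i * x i). (\<Sum>i\<in>I. \<phi> i * x i) \<in> {0<..t}})"
    (is "holomorphic_germ (\<lambda>t. measure _ (?piece t))")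
    and "{x \<in> scaled_region I v A 0 (\<Sum>i\<in>I. \<phi> i * x i). (\<Sum>i\<in>I. \<phi> i * x i) \<in> {0<..t}} \<in> sets (lebesgue_PiM I)"
proof -
  define J where "J = I - {j}"
  have J: "finite J" using I by (simp add: J_def)
  define v' where "v' = (\<lambda>i. v i - (\<phi> i / \<phi> j) *\<^sub>R v j)"
  define w where "w = v j /\<^sub>R \<phi> j"
  define A' where "A' = (\<lambda>(\<psi>, b). (\<lambda>i. \<psi> i - \<psi> j / \<phi> j * \<phi> i, b - \<psi> j / \<phi> j)) ` A"
  have A': "finite A'" using A by (simp add: A'_def)
  have v': "coercive J v'" unfolding J_def v'_def by (rule coercive_slice[OF v I j(1)])
  define H where "H = (\<lambda>s. measure (lebesgue_PiM J) (scaled_region J v' A' w s))"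
  have germ_H: "holomorphic_germ H"
    unfolding H_def
    by (rule holomorphic_germ_scaled_region_shift[OF J A'])
       (rule germ[folded J_def, OF v'])
  \<comment> \<open>The time at which the region is taken depends on \<open>x\<close>, so
    measurability is read off the constraints written out with \<open>x\<close> on both
    sides.\<close>
  have piece_eq: "?piece t = {x \<in> space (lebesgue_PiM I). norm (\<Sum>i\<in>I. x i *\<^sub>R v i) \<le> 1} \<inter>
      {x \<in> space (lebesgue_PiM I). \<forall>p\<in>A. (\<Sum>i\<in>I. fst p i * x i) \<le> (\<Sum>i\<in>I. \<phi> i * x i) * snd p} \<inter>
      {x \<in> space (lebesgue_PiM I). (\<Sum>i\<in>I. \<phi> i * x i) \<in> {0<..t}}" for t
    by (auto simp: scaled_region_def)
  have constr: "{x \<in> space (lebesgue_PiM I). \<forall>p\<in>A. (\<Sum>i\<in>I. fst p i * x i) \<le> (\<Sum>i\<in>I. \<phi> i * x i) * snd p} \<in> sets (lebesgue_PiM I)"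
    by (rule sets.sets_Collect_finite_All[OF _ A]) measurable
  show piece[measurable]: "?piece t \<in> sets (lebesgue_PiM I)" for t
    unfolding piece_eq by (intro sets.Int constr) measurable
  have slice_iff: "x(j := (s - (\<Sum>i\<in>J. \<phi> i * x i)) / \<phi> j) \<in> ?piece t \<longleftrightarrow>
      s \<in> {0<..t} \<and> x \<in> scaled_region J v' A' w s" (is "?X \<in> _ \<longleftrightarrow> _")
    if x: "x \<in> space (lebesgue_PiM J)" for x s t
  proof -
    have 1: "(\<Sum>i\<in>I. \<phi> i * ?X i) = s"
      unfolding J_def sum_fun_upd_slice[OF I j(1)] using j(2) by simp
    have 2: "(\<Sum>i\<in>I. ?X i *\<^sub>R v i) = s *\<^sub>R w + (\<Sum>i\<in>J. x i *\<^sub>R v' i)"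
      unfolding J_def sum_scaleR_fun_upd_slice[OF I j(1)] by (simp add: w_def v'_def)
    have 3: "(\<Sum>i\<in>I. \<psi> i * ?X i) \<le> s * b \<longleftrightarrow>
        (\<Sum>i\<in>J. (\<psi> i - \<psi> j / \<phi> j * \<phi> i) * x i) \<le> s * (b - \<psi> j / \<phi> j)" for \<psi> b
      unfolding J_def sum_fun_upd_slice[OF I j(1)] by (simp add: right_diff_distrib) linarith
    have 4: "?X \<in> space (lebesgue_PiM I)"
      using x j(1) by (auto simp: space_PiM J_def PiE_iff extensional_def)
    have "?X \<in> scaled_region I v A 0 s \<longleftrightarrow> x \<in> scaled_region J v' A' w s"
      unfolding scaled_region_def mem_Collect_eq 2 using x 3 4 by (auto simp: A'_def)
    then show ?thesis unfolding mem_Collect_eq 1 by blast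
  qed
  have emeasure_H: "emeasure (lebesgue_PiM J) (scaled_region J v' A' w s) = ennreal (H s)" for s
    unfolding H_def using scaled_region_fmeasurable[OF v' J A']
    by (intro emeasure_eq_measure2)
  \<comment> \<open>\<open>H s\<close> is the measure of the section over \<open>s\<close> of one
    jointly measurable set \<open>?Q\<close>.\<close>
  have H_meas: "H \<in> borel_measurable borel"
  proof -
    interpret sigma_finite_measure "lebesgue_PiM J" by (rule sigma_finite_lebesgue_PiM[OF J])
    let ?M = "(borel :: real measure) \<Otimes>\<^sub>M lebesgue_PiM J"
    have constr': "{p \<in> space ?M. \<forall>q\<in>A'. (\<Sum>i\<in>J. fst q i * snd p i) \<le> fst p * snd q} \<in> sets ?M"
      by (rule sets.sets_Collect_finite_All[OF _ A']) measurable
    have "{p \<in> space ?M. norm (fst p *\<^sub>R w + (\<Sum>i\<in>J. snd p i *\<^sub>R v' i)) \<le> 1} \<inter>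
        {p \<in> space ?M. \<forall>q\<in>A'. (\<Sum>i\<in>J. fst q i * snd p i) \<le> fst p * snd q} \<in> sets ?M" (is "?Q \<in> _")
      by (intro sets.Int constr') measurable
    then have "(\<lambda>s. emeasure (lebesgue_PiM J) (Pair s -` ?Q)) \<in> borel_measurable borel"
      by (rule measurable_emeasure_Pair)
    moreover have "Pair s -` ?Q = scaled_region J v' A' w s" for s
      by (auto simp: scaled_region_def space_pair_measure)
    ultimately show ?thesis unfolding H_def measure_def by simp
  qed
  have eq: "measure (lebesgue_PiM I) (?piece t) =
      1 / \<bar>\<phi> j\<bar> * enn2real (\<integral>\<^sup>+s. ennreal (H s) * indicator {0<..t} s \<partial>lborel)" for t
  proof -
    have "emeasure (lebesgue_PiM I) (?piece t) = (\<integral>\<^sup>+x. indicator (?piece t) x \<partial>lebesgue_PiM I)"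
      by (rule nn_integral_indicator[symmetric]) measurable
    also have "\<dots> = ennreal (1 / \<bar>\<phi> j\<bar>) * (\<integral>\<^sup>+s. \<integral>\<^sup>+x.
        indicator (?piece t) (x(j := (s - (\<Sum>i\<in>J. \<phi> i * x i)) / \<phi> j)) \<partial>lebesgue_PiM J \<partial>lborel)"
      unfolding J_def by (rule nn_integral_lebesgue_PiM_slice[where \<phi> = \<phi> and j = j, OF I j]) measurable
    also have "(\<integral>\<^sup>+s. \<integral>\<^sup>+x. indicator (?piece t) (x(j := (s - (\<Sum>i\<in>J. \<phi> i * x i)) / \<phi> j)) \<partial>lebesgue_PiM J \<partial>lborel)
        = (\<integral>\<^sup>+s. ennreal (H s) * indicator {0<..t} s \<partial>lborel)"
    proof (rule nn_integral_cong)
      fix s :: real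
      have "(\<integral>\<^sup>+x. indicator (?piece t) (x(j := (s - (\<Sum>i\<in>J. \<phi> i * x i)) / \<phi> j)) \<partial>lebesgue_PiM J) =
          (\<integral>\<^sup>+x. indicator {0<..t} s * indicator (scaled_region J v' A' w s) x \<partial>lebesgue_PiM J)"
        by (rule nn_integral_cong) (simp only: indicator_def slice_iff, simp)
      also have "\<dots> = indicator {0<..t} s * emeasure (lebesgue_PiM J) (scaled_region J v' A' w s)"
        by (rule nn_integral_cmult_indicator) (rule scaled_region_sets[OF A' J])
      finally show "(\<integral>\<^sup>+x. indicator (?piece t) (x(j := (s - (\<Sum>i\<in>J. \<phi> i * x i)) / \<phi> j)) \<partial>lebesgue_PiM J)
          = ennreal (H s) * indicator {0<..t} s"
        by (simp add: emeasure_H mult.commute)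
    qed
    finally show ?thesis by (simp add: measure_def enn2real_mult)
  qed
  show "holomorphic_germ (\<lambda>t. measure (lebesgue_PiM I) (?piece t))"
    unfolding eq
    by (intro holomorphic_germ_mult holomorphic_germ_const holomorphic_germ_nn_integral germ_H H_meas)
       (simp add: H_def)
qed

section \<open>Signs of the constraints and the induction on dimension\<close>

text \<open>A half-space and its opposite cover everything and meet in a null hyperplane. This
  trades a constraint with \<open>b < 0\<close> for one with positive bound.\<close>

lemma measure_scaled_region_negate:
  fixes v :: "'i \<Rightarrow> 'a::euclidean_space"
  assumes I: "finite I" and A: "finite A" and v: "coercive I v" and j: "j \<in> I" "\<phi> j \<noteq> 0"
  shows "measure (lebesgue_PiM I) (scaled_region I v (insert (\<phi>, b) A) w t) =
    measure (lebesgue_PiM I) (scaled_region I v A w t) -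
    measure (lebesgue_PiM I) (scaled_region I v (insert (\<lambda>i. - \<phi> i, - b) A) w t)"
proof -
  let ?R = "\<lambda>A. scaled_region I v A w t"
  have "?R A = ?R (insert (\<phi>, b) A) \<union> ?R (insert (\<lambda>i. - \<phi> i, - b) A)"
    by (auto simp: scaled_region_def sum_negf)
  moreover have "measure (lebesgue_PiM I) (?R (insert (\<phi>, b) A) \<union> ?R (insert (\<lambda>i. - \<phi> i, - b) A)) =
      measure (lebesgue_PiM I) (?R (insert (\<phi>, b) A)) +
      measure (lebesgue_PiM I) (?R (insert (\<lambda>i. - \<phi> i, - b) A))"
  proof (rule measure_Un_AE)
    show "AE x in lebesgue_PiM I. x \<notin> ?R (insert (\<phi>, b) A) \<or> x \<notin> ?R (insert (\<lambda>i. - \<phi> i, - b) A)"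
      using AE_lebesgue_PiM_hyperplane[where \<phi> = \<phi> and j = j and b = "t * b", OF I j]
      by (rule AE_mp) (auto simp: scaled_region_def sum_negf)
  qed (use A in \<open>auto intro!: scaled_region_fmeasurable[OF v I]\<close>)
  ultimately show ?thesis by simp
qed

text \<open>For nonnegative bounds the region grows with \<open>t\<close>. A point outside
  \<open>R 0\<close> enters at the largest value that the normalised functionals take on it, through
  a facet attaining that value. So the volume is that of \<open>R 0\<close> plus those of the
  pieces, which overlap in null sets.\<close>

lemma holomorphic_germ_scaled_region_nonneg:
  fixes v :: "'i \<Rightarrow> 'a::euclidean_space"
  assumes I: "finite I" and A: "finite A" and v: "coercive I v" and nonneg: "\<And>\<phi> b. (\<phi>, b) \<in> A \<Longrightarrow> 0 \<le> b"
    and germ: "\<And>j (v :: 'i \<Rightarrow> 'a) A. j \<in> I \<Longrightarrow> coercive (I - {j}) v \<Longrightarrow> finite A \<Longrightarrow>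
      holomorphic_germ (\<lambda>t. measure (lebesgue_PiM (I - {j})) (scaled_region (I - {j}) v A 0 t))"
  shows "holomorphic_germ (\<lambda>t. measure (lebesgue_PiM I) (scaled_region I v A 0 t))"
proof -
  define ev where "ev = (\<lambda>\<phi> x. \<Sum>i\<in>I. \<phi> i * x i :: real)"
  define R where "R = scaled_region I v A 0"
  \<comment> \<open>Dividing by \<open>b > 0\<close> turns these constraints into
    \<open>ev \<phi> x \<le> t\<close>, so \<open>ev \<phi> x\<close> is an entry time. Restriction
    to \<open>I\<close> makes distinct members differ at an index in \<open>I\<close>; the zero
    functional is removed because it has no hyperplane to slice along.\<close>
  define \<Phi> where "\<Phi> = (\<lambda>(\<phi>, b). \<lambda>i\<in>I. \<phi> i / b) ` {p \<in> A. 0 < snd p} - {\<lambda>i\<in>I. 0}"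
  \<comment> \<open>\<open>piece \<phi> t\<close>: the points that enter the growing region at time \<open>ev \<phi> x \<in> {0<..t}\<close>, through the facet \<open>\<phi>\<close>\<close>
  define piece where "piece = (\<lambda>\<phi> t. {x \<in> R (ev \<phi> x). ev \<phi> x \<in> {0<..t}})"
  have \<Phi>: "finite \<Phi>" using A by (simp add: \<Phi>_def)
  have ext: "\<phi> \<in> extensional I" if "\<phi> \<in> \<Phi>" for \<phi> using that by (auto simp: \<Phi>_def)
  have nz: "\<exists>j\<in>I. \<phi> j \<noteq> 0" if "\<phi> \<in> \<Phi>" for \<phi>
  proof (rule ccontr)
    assume "\<not> (\<exists>j\<in>I. \<phi> j \<noteq> 0)"
    then have "\<phi> = (\<lambda>i\<in>I. 0)" using ext[OF that] by (intro extensionalityI[of _ I]) auto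
    then show False using that by (simp add: \<Phi>_def)
  qed
  have ev_restrict: "ev (\<lambda>i\<in>I. \<phi> i / b) x = ev \<phi> x / b" for \<phi> b x
    by (simp add: ev_def sum_divide_distrib)
  \<comment> \<open>Constraints with \<open>b = 0\<close> do not depend on time, and those with a
    zero functional and \<open>b > 0\<close> hold for all \<open>s \<ge> 0\<close>.\<close>
  have R_iff: "x \<in> R s \<longleftrightarrow> x \<in> space (lebesgue_PiM I) \<and> norm (\<Sum>i\<in>I. x i *\<^sub>R v i) \<le> 1 \<and>
      (\<forall>\<psi>. (\<psi>, 0) \<in> A \<longrightarrow> ev \<psi> x \<le> 0) \<and> (\<forall>\<psi>\<in>\<Phi>. ev \<psi> x \<le> s)" if "0 \<le> s" for x s
  proof -
    have "(\<forall>(\<psi>, b)\<in>A. ev \<psi> x \<le> s * b) \<longleftrightarrow>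
        (\<forall>\<psi>. (\<psi>, 0) \<in> A \<longrightarrow> ev \<psi> x \<le> 0) \<and> (\<forall>\<psi>\<in>\<Phi>. ev \<psi> x \<le> s)" (is "?L \<longleftrightarrow> ?R1 \<and> ?R2")
    proof (intro iffI conjI)
      assume L: ?L
      show ?R1 using L by fastforce
      show ?R2
      proof
        fix \<psi> assume "\<psi> \<in> \<Phi>"
        then obtain \<phi> b where p: "(\<phi>, b) \<in> A" "0 < b" "\<psi> = (\<lambda>i\<in>I. \<phi> i / b)" by (auto simp: \<Phi>_def)
        then have "ev \<phi> x \<le> s * b" using L by auto
        then show "ev \<psi> x \<le> s" using p(2) by (simp add: p(3) ev_restrict field_simps)
      qed
    next
      assume R: "?R1 \<and> ?R2"
      have "ev \<phi> x \<le> s * b" if p: "(\<phi>, b) \<in> A" for \<phi> b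
      proof (cases "b = 0")
        case True
        then show ?thesis using R p by auto
      next
        case False
        then have b: "0 < b" using nonneg[OF p] by simp
        have "ev (\<lambda>i\<in>I. \<phi> i / b) x \<le> s"
        proof (cases "(\<lambda>i\<in>I. \<phi> i / b) = (\<lambda>i\<in>I. 0)")
          case True
          then show ?thesis using \<open>0 \<le> s\<close> by (simp only:) (simp add: ev_def)
        next
          case False
          then have "(\<lambda>i\<in>I. \<phi> i / b) \<in> \<Phi>" using p b by (force simp: \<Phi>_def)
          then show ?thesis using R by blast
        qed
        then show ?thesis using b by (simp add: ev_restrict field_simps)
      qed
      then show ?L by auto
    qed
    then show ?thesis by (simp add: R_def scaled_region_def ev_def)
  qed
  have piece_sets: "piece \<phi> t \<in> sets (lebesgue_PiM I)"
    and piece_germ: "holomorphic_germ (\<lambda>t. measure (lebesgue_PiM I) (piece \<phi> t))" if phi: "\<phi> \<in> \<Phi>" for \<phi> t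
  proof -
    obtain j where j: "j \<in> I" "\<phi> j \<noteq> 0" using nz[OF phi] by blast
    show "piece \<phi> t \<in> sets (lebesgue_PiM I)"
      unfolding piece_def R_def ev_def
      by (rule holomorphic_germ_facet_piece(2)[where \<phi> = \<phi> and j = j, OF I A v j germ[OF j(1)]])
    show "holomorphic_germ (\<lambda>t. measure (lebesgue_PiM I) (piece \<phi> t))"
      unfolding piece_def R_def ev_def
      by (rule holomorphic_germ_facet_piece(1)[where \<phi> = \<phi> and j = j, OF I A v j germ[OF j(1)]])
  qed
  have piece_fm: "piece \<phi> t \<in> fmeasurable (lebesgue_PiM I)" if "\<phi> \<in> \<Phi>" for \<phi> t
    by (rule fmeasurable_coercive[OF v I piece_sets[OF that], of _ 1])
       (auto simp: piece_def R_def scaled_region_def)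
  have R_fm: "R t \<in> fmeasurable (lebesgue_PiM I)" for t
    unfolding R_def by (rule scaled_region_fmeasurable[OF v I A])
  have decomp: "R t = R 0 \<union> (\<Union>\<phi>\<in>\<Phi>. piece \<phi> t)" if t: "0 < t" for t
  proof (intro equalityI subsetI)
    fix x assume x: "x \<in> R t"
    show "x \<in> R 0 \<union> (\<Union>\<phi>\<in>\<Phi>. piece \<phi> t)"
    proof (cases "x \<in> R 0")
      case False
      then obtain \<psi> where \<psi>: "\<psi> \<in> \<Phi>" "0 < ev \<psi> x"
        using x t by (auto simp: R_iff not_le)
      \<comment> \<open>The entry time of \<open>x\<close>: positive since \<open>x\<close> is
        outside \<open>R 0\<close>, at most \<open>t\<close> since \<open>x\<close> is in
        \<open>R t\<close>, and attained by the facet through which \<open>x\<close> enters.\<close>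
      define m where "m = Max ((\<lambda>\<phi>. ev \<phi> x) ` \<Phi>)"
      have le: "ev \<phi> x \<le> m" if "\<phi> \<in> \<Phi>" for \<phi> unfolding m_def using \<Phi> that by (intro Max_ge) auto
      have "m \<in> (\<lambda>\<phi>. ev \<phi> x) ` \<Phi>" unfolding m_def using \<Phi> \<psi> by (intro Max_in) auto
      then obtain \<phi> where \<phi>: "\<phi> \<in> \<Phi>" "m = ev \<phi> x" by blast
      have "0 < m" using le[OF \<psi>(1)] \<psi>(2) by simp
      moreover have "m \<le> t" using x t \<phi> by (auto simp: R_iff)
      moreover have "x \<in> R m" using x t le \<open>0 < m\<close> by (simp add: R_iff)
      ultimately have "x \<in> piece \<phi> t" by (simp add: piece_def \<phi>(2))
      then show ?thesis using \<phi>(1) by blast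
    qed simp
  next
    fix x assume "x \<in> R 0 \<union> (\<Union>\<phi>\<in>\<Phi>. piece \<phi> t)"
    then show "x \<in> R t"
    proof
      assume "x \<in> R 0"
      then show ?thesis using t by (auto simp: R_iff intro: order_trans)
    next
      assume "x \<in> (\<Union>\<phi>\<in>\<Phi>. piece \<phi> t)"
      then obtain \<phi> where "\<phi> \<in> \<Phi>" "x \<in> R (ev \<phi> x)" "0 < ev \<phi> x" "ev \<phi> x \<le> t" by (auto simp: piece_def)
      then show ?thesis using t by (auto simp: R_iff intro: order_trans)
    qed
  qed
  \<comment> \<open>A point in both pieces enters through both facets at once, so it lies on the
    hyperplane of the nonzero functional \<open>\<phi> - \<psi>\<close>.\<close>
  have ae: "AE x in lebesgue_PiM I. x \<notin> piece \<phi> t \<or> x \<notin> piece \<psi> t"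
    if \<phi>: "\<phi> \<in> \<Phi>" and \<psi>: "\<psi> \<in> \<Phi>" and ne: "\<phi> \<noteq> \<psi>" for \<phi> \<psi> t
  proof -
    obtain j where j: "j \<in> I" "\<phi> j - \<psi> j \<noteq> 0"
      using extensionalityI[OF ext[OF \<phi>] ext[OF \<psi>]] ne by auto
    have "ev (\<lambda>i. \<phi> i - \<psi> i) x = ev \<phi> x - ev \<psi> x" for x
      by (simp add: ev_def left_diff_distrib sum_subtractf)
    then have "AE x in lebesgue_PiM I. ev \<phi> x - ev \<psi> x \<noteq> 0"
      using AE_lebesgue_PiM_hyperplane[where \<phi> = "\<lambda>i. \<phi> i - \<psi> i" and j = j and b = 0, OF I j]
      by (simp add: ev_def)
    then show ?thesis
    proof (rule AE_mp, intro AE_I2 impI)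
      fix x assume "ev \<phi> x - ev \<psi> x \<noteq> 0"
      moreover have "ev \<psi> x \<le> ev \<phi> x" if "x \<in> piece \<phi> t" using that \<psi> by (auto simp: piece_def R_iff)
      moreover have "ev \<phi> x \<le> ev \<psi> x" if "x \<in> piece \<psi> t" using that \<phi> by (auto simp: piece_def R_iff)
      ultimately show "x \<notin> piece \<phi> t \<or> x \<notin> piece \<psi> t" by force
    qed
  qed
  have "measure (lebesgue_PiM I) (R t) =
      measure (lebesgue_PiM I) (R 0) + (\<Sum>\<phi>\<in>\<Phi>. measure (lebesgue_PiM I) (piece \<phi> t))" if t: "0 < t" for t
  proof -
    have "R 0 \<inter> (\<Union>\<phi>\<in>\<Phi>. piece \<phi> t) = {}" by (fastforce simp: R_iff piece_def)
    then have "measure (lebesgue_PiM I) (R t) =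
        measure (lebesgue_PiM I) (R 0) + measure (lebesgue_PiM I) (\<Union>\<phi>\<in>\<Phi>. piece \<phi> t)"
      unfolding decomp[OF t] using \<Phi>
      by (intro measure_Un_AE R_fm fmeasurable.finite_UN AE_I2 piece_fm) auto
    also have "measure (lebesgue_PiM I) (\<Union>\<phi>\<in>\<Phi>. piece \<phi> t) = (\<Sum>\<phi>\<in>\<Phi>. measure (lebesgue_PiM I) (piece \<phi> t))"
      by (intro measure_UNION_AE \<Phi> piece_fm pairwiseI ae)
    finally show ?thesis .
  qed
  then show ?thesis
    unfolding R_def[symmetric]
    by (intro holomorphic_germ_cong[OF holomorphic_germ_add[OF holomorphic_germ_const
            holomorphic_germ_sum[OF piece_germ]] zero_less_one])
qed

text \<open>Strong induction on \<open>card I\<close> supplies the facets; an inner induction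
  removes negative bounds. The case \<open>I = {}\<close> follows the same path: every functional
  vanishes there, so no pieces arise.\<close>

theorem holomorphic_germ_scaled_region:
  fixes v :: "'i \<Rightarrow> 'a::euclidean_space"
  assumes "finite I" "finite A" "coercive I v"
  shows "holomorphic_germ (\<lambda>t. measure (lebesgue_PiM I) (scaled_region I v A 0 t))"
  using assms
proof (induction "card I" arbitrary: I v A rule: less_induct)
  case less
  note I = less.prems(1) and v = less.prems(3)
  have nonneg: "holomorphic_germ (\<lambda>t. measure (lebesgue_PiM I) (scaled_region I v B 0 t))"
    if "finite B" "\<And>\<phi> b. (\<phi>, b) \<in> B \<Longrightarrow> 0 \<le> b" for B
  proof (rule holomorphic_germ_scaled_region_nonneg[OF I that(1) v that(2)])
    fix j and v :: "'i \<Rightarrow> 'a" and A :: "(('i \<Rightarrow> real) \<times> real) set"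
    assume "j \<in> I" "coercive (I - {j}) v" "finite A"
    then show "holomorphic_germ (\<lambda>t. measure (lebesgue_PiM (I - {j})) (scaled_region (I - {j}) v A 0 t))"
      using I by (intro less.hyps card_Diff1_less) auto
  qed
  \<comment> \<open>\<open>N\<close> collects the negative bounds. Each step drops one of them or
    moves its negation into \<open>B\<close>, so \<open>B\<close> must vary in the
    induction.\<close>
  have signed: "holomorphic_germ (\<lambda>t. measure (lebesgue_PiM I) (scaled_region I v (N \<union> B) 0 t))"
    if "finite N" "\<And>\<phi> b. (\<phi>, b) \<in> N \<Longrightarrow> b < 0" "finite B" "\<And>\<phi> b. (\<phi>, b) \<in> B \<Longrightarrow> 0 \<le> b" for N B
    using that
  proof (induction N arbitrary: B rule: finite_induct)
    case empty
    then show ?case using nonneg by simp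
  next
    case (insert p N)
    obtain \<phi> b where p: "p = (\<phi>, b)" by (cases p)
    have b: "b < 0" using insert.prems(1) p by auto
    show ?case
    proof (cases "\<exists>j\<in>I. \<phi> j \<noteq> 0")
      case True
      then obtain j where j: "j \<in> I" "\<phi> j \<noteq> 0" by blast
      have "holomorphic_germ (\<lambda>t. measure (lebesgue_PiM I) (scaled_region I v (N \<union> B) 0 t) -
          measure (lebesgue_PiM I) (scaled_region I v (N \<union> insert (\<lambda>i. - \<phi> i, - b) B) 0 t))"
      proof (rule holomorphic_germ_diff)
        show "holomorphic_germ (\<lambda>t. measure (lebesgue_PiM I) (scaled_region I v (N \<union> B) 0 t))"
          using insert.prems by (intro insert.IH) auto
        show "holomorphic_germ (\<lambda>t. measure (lebesgue_PiM I)
            (scaled_region I v (N \<union> insert (\<lambda>i. - \<phi> i, - b) B) 0 t))"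
          using insert.prems b by (intro insert.IH) auto
      qed
      then show ?thesis
        using measure_scaled_region_negate[where \<phi> = \<phi> and j = j and A = "N \<union> B" and b = b and w = 0, OF I _ v j]
          insert.hyps insert.prems(2) by (simp add: p)
    next
      case False
      \<comment> \<open>The functional vanishes on \<open>I\<close>, so the constraint reads
        \<open>0 \<le> t * b\<close> with \<open>b < 0\<close>.\<close>
      then have "scaled_region I v (insert p N \<union> B) 0 t = {}" if "0 < t" for t
        using that b by (auto simp: scaled_region_def p mult_le_0_iff not_le mult_pos_neg)
      then show ?thesis
        by (intro holomorphic_germ_cong[OF holomorphic_germ_const[of 0] zero_less_one]) simp
    qed
  qed
  have "holomorphic_germ (\<lambda>t. measure (lebesgue_PiM I)
      (scaled_region I v ({p \<in> A. snd p < 0} \<union> {p \<in> A. 0 \<le> snd p}) 0 t))"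
    by (rule signed) (use less.prems(2) in auto)
  moreover have "{p \<in> A. snd p < 0} \<union> {p \<in> A. 0 \<le> snd p} = A" by auto
  ultimately show ?case by simp
qed

section \<open>Volume growth of polyhedral sets\<close>

lemma coercive_Basis: "coercive (Basis :: 'a::euclidean_space set) (\<lambda>i. i)"
  unfolding coercive_def
proof (intro exI[of _ 1] allI ballI)
  fix x :: "'a \<Rightarrow> real" and i :: 'a assume "i \<in> Basis"
  then show "\<bar>x i\<bar> \<le> 1 * norm (\<Sum>i\<in>Basis. x i *\<^sub>R i)"
    using Basis_le_norm[of i "\<Sum>i\<in>Basis. x i *\<^sub>R i"] by simp
qed

text \<open>Expansion in the standard basis carries the product measure to \<open>lborel\<close>;
  the set is closed, so \<open>lebesgue\<close> gives it the same measure.\<close>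

lemma holomorphic_germ_polyhedron:
  fixes a :: "'h \<Rightarrow> 'a::euclidean_space" and b :: "'h \<Rightarrow> real"
  assumes "finite F"
  shows "holomorphic_germ (\<lambda>t. measure lebesgue {x. norm x \<le> 1 \<and> (\<forall>h\<in>F. a h \<bullet> x \<le> t * b h)})"
proof -
  let ?A = "(\<lambda>h. (\<lambda>i. a h \<bullet> i, b h)) ` F" and ?T = "\<lambda>x. \<Sum>i\<in>Basis. x i *\<^sub>R i :: 'a"
  have "measure lebesgue {x. norm x \<le> 1 \<and> (\<forall>h\<in>F. a h \<bullet> x \<le> t * b h)} =
      measure (lebesgue_PiM Basis) (scaled_region Basis (\<lambda>i. i) ?A 0 t)" for t
  proof -
    let ?S = "{x. norm x \<le> 1 \<and> (\<forall>h\<in>F. a h \<bullet> x \<le> t * b h)}"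
    have "?S = cball 0 1 \<inter> (\<Inter>h\<in>F. {x. a h \<bullet> x \<le> t * b h})" by auto
    then have "closed ?S" by (auto intro: closed_halfspace_le)
    then have S: "?S \<in> sets borel" by (rule borel_closed)
    then have "measure lebesgue ?S = measure lborel ?S" by simp
    also have "\<dots> = measure (distr (lebesgue_PiM Basis) borel ?T) ?S" by (subst lborel_eq) simp
    also have "\<dots> = measure (lebesgue_PiM Basis) (?T -` ?S \<inter> space (lebesgue_PiM Basis))"
      by (rule measure_distr) (use S in \<open>auto intro!: borel_measurable_sum borel_measurable_scaleR\<close>)
    also have "?T -` ?S \<inter> space (lebesgue_PiM Basis) = scaled_region Basis (\<lambda>i. i) ?A 0 t"
      by (auto simp: scaled_region_def inner_sum_right mult.commute)
    finally show ?thesis .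
  qed
  then show ?thesis
    using holomorphic_germ_scaled_region[OF finite_Basis _ coercive_Basis, of ?A] assms by simp
qed

text \<open>The map \<open>r *\<^sub>R x + p0\<close> takes the unit ball to the ball around
  \<open>p0\<close> and scales volume by \<open>r ^ DIM('a)\<close>.\<close>

lemma Vfun_halfspaces_scale:
  fixes a :: "'h \<Rightarrow> 'a::euclidean_space"
  assumes "0 < r"
  shows "Vfun {x. \<forall>h\<in>F. a h \<bullet> x \<le> b h} p0 r =
    r ^ DIM('a) * measure lebesgue {x. norm x \<le> 1 \<and> (\<forall>h\<in>F. a h \<bullet> x \<le> 1 / r * (b h - a h \<bullet> p0))}"
proof -
  let ?S = "{x. norm x \<le> 1 \<and> (\<forall>h\<in>F. a h \<bullet> x \<le> 1 / r * (b h - a h \<bullet> p0))}"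
  have "{x. \<forall>h\<in>F. a h \<bullet> x \<le> b h} \<inter> cball p0 r = (\<lambda>x. r *\<^sub>R x + p0) ` ?S"
  proof (intro equalityI subsetI)
    fix x assume x: "x \<in> {x. \<forall>h\<in>F. a h \<bullet> x \<le> b h} \<inter> cball p0 r"
    have "norm (x - p0) \<le> r" using x by (simp add: dist_norm norm_minus_commute)
    then have "norm ((x - p0) /\<^sub>R r) \<le> 1" using assms
      unfolding norm_scaleR by (simp add: field_simps)
    moreover have "a h \<bullet> ((x - p0) /\<^sub>R r) \<le> 1 / r * (b h - a h \<bullet> p0)" if "h \<in> F" for h
      using x assms that by (simp add: inner_diff_right field_simps)
    ultimately have "(x - p0) /\<^sub>R r \<in> ?S" by blast
    then show "x \<in> (\<lambda>x. r *\<^sub>R x + p0) ` ?S"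
      using assms by (intro image_eqI[of _ _ "(x - p0) /\<^sub>R r"]) auto
  next
    fix x assume "x \<in> (\<lambda>x. r *\<^sub>R x + p0) ` ?S"
    then show "x \<in> {x. \<forall>h\<in>F. a h \<bullet> x \<le> b h} \<inter> cball p0 r"
      using assms by (auto simp: dist_norm inner_add_right field_simps)
  qed
  then show ?thesis
    using assms measure_lebesgue_affine[of r p0 ?S] by (simp add: Vfun_def)
qed

theorem mainTheorem7:
  fixes P :: "'a::euclidean_space set" and p0 :: 'a
  assumes "polyhedral_set P"
  shows "\<exists>R>0. \<exists>F :: complex \<Rightarrow> complex.
           F holomorphic_on {z. norm z > R} \<and>
           (\<exists>C R'. \<forall>z. norm z > R' \<longrightarrow> norm (F z / z ^ DIM('a)) \<le> C) \<and>
           (\<forall>r::real. r > R \<longrightarrow> F (complex_of_real r) = complex_of_real (Vfun P p0 r))"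
proof -
  obtain H where H: "finite H" "P = \<Inter>H" "\<forall>h\<in>H. \<exists>a b. a \<noteq> 0 \<and> h = {x. a \<bullet> x \<le> b}"
    using assms unfolding polyhedral_set_def polyhedron_def by blast
  then obtain a b where ab: "\<And>h. h \<in> H \<Longrightarrow> h = {x. a h \<bullet> x \<le> b h}" by metis
  have P: "P = {x. \<forall>h\<in>H. a h \<bullet> x \<le> b h}" unfolding H(2) using ab by blast
  let ?f = "\<lambda>t. measure lebesgue {x. norm x \<le> 1 \<and> (\<forall>h\<in>H. a h \<bullet> x \<le> t * (b h - a h \<bullet> p0))}"
  obtain \<delta> g where g: "0 < \<delta>" "g holomorphic_on ball 0 \<delta>"
    "\<And>t. 0 < t \<Longrightarrow> t < \<delta> \<Longrightarrow> complex_of_real (?f t) = g (complex_of_real t)"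
    using holomorphic_germ_polyhedron[OF H(1), of a "\<lambda>h. b h - a h \<bullet> p0"]
    by (rule holomorphic_germE) blast
  \<comment> \<open>Undoing \<open>t = 1 / r\<close>: the power is the volume factor, and
    \<open>1 / z\<close> lies in the disc of \<open>g\<close> once
    \<open>norm z > 1 / \<delta>\<close>.\<close>
  define F where "F = (\<lambda>z. z ^ DIM('a) * g (1 / z))"
  have small: "norm (1 / z) < \<epsilon>" if "1 / \<epsilon> < norm z" "0 < \<epsilon>" for z :: complex and \<epsilon>
  proof -
    have "0 < norm z" using that by (smt (verit) divide_pos_pos)
    then show ?thesis using that by (simp add: norm_divide field_simps)
  qed
  have nz: "z \<noteq> 0" if "1 / \<delta> < norm z" for z :: complex
    using that g(1) by (metis divide_pos_pos norm_zero order_less_asym zero_less_one)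
  \<comment> \<open>\<open>g\<close> may be unbounded on its open disc, so the bound is taken on the
    closed disc of half the radius, that is, for \<open>norm z > 2 / \<delta>\<close>.\<close>
  have "compact (g ` cball 0 (\<delta> / 2))"
    by (intro compact_continuous_image continuous_on_subset[OF holomorphic_on_imp_continuous_on[OF g(2)]])
       (use g(1) in auto)
  then have "bounded (g ` cball 0 (\<delta> / 2))" by (rule compact_imp_bounded)
  then obtain C where C: "\<And>z. z \<in> cball 0 (\<delta> / 2) \<Longrightarrow> norm (g z) \<le> C"
    unfolding bounded_iff by blast
  show ?thesis
  proof (intro exI conjI allI impI)
    show "0 < 1 / \<delta>" using g(1) by simp
    have "(g \<circ> (\<lambda>z. 1 / z)) holomorphic_on {z. 1 / \<delta> < norm z}"
    proof (rule holomorphic_on_compose_gen[OF _ g(2)])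
      show "(\<lambda>z. 1 / z) holomorphic_on {z. 1 / \<delta> < norm z}"
        using nz by (intro holomorphic_intros) blast
      show "(\<lambda>z. 1 / z) ` {z :: complex. 1 / \<delta> < norm z} \<subseteq> ball 0 \<delta>"
        using small[OF _ g(1)] unfolding image_subset_iff mem_ball_0 by blast
    qed
    then show "F holomorphic_on {z. 1 / \<delta> < norm z}"
      unfolding F_def comp_def by (intro holomorphic_intros)
  next
    fix z :: complex assume z: "1 / (\<delta> / 2) < norm z"
    have "z \<noteq> 0" using z g(1) by (intro nz) (simp add: field_simps)
    then have "F z / z ^ DIM('a) = g (1 / z)" by (simp add: F_def)
    then show "norm (F z / z ^ DIM('a)) \<le> C"
      using C[of "1 / z"] small[OF z] g(1) by (simp add: less_imp_le)
  next
    fix r :: real assume r: "1 / \<delta> < r"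
    have r0: "0 < r" using r g(1) by (smt (verit) divide_pos_pos)
    then have "complex_of_real (?f (1 / r)) = g (complex_of_real (1 / r))"
      using r g(1) by (intro g(3)) (auto simp: field_simps)
    then show "F (complex_of_real r) = complex_of_real (Vfun P p0 r)"
      unfolding P Vfun_halfspaces_scale[OF r0] F_def by simp
  qed
qed

end
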